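(* Let $V$ be any set, let $\mathcal{G}$ be any undirected graph on $V$, and suppose the ternary relation $\cdot \perp \cdot \mid \cdot$ on the power set $\mathcal{P}(V)$ satisfies (P1* ), (P2* ), (P3* ) and (P4* ). Then, with respect to $\mathcal{G}$, $$(V,\perp)\text{ satisfies (G* )} \;\Rightarrow\; (V,\perp)\text{ satisfies (L* )} \;\Rightarrow\; (V,\perp)\text{ satisfies (P* )}.$$ If, in addition, $\cdot \perp \cdot \mid \cdot$ satisfies (P5* ), then we also have $$(V,\perp)\text{ satisfies (P* )} \;\Rightarrow\; (V,\perp)\text{ satisfies (G* )}.$$
   Context: Undirected graphs have no loops and no multiple edges. For a vertex $i$, $\mathrm{ne}(i)$ is its set of neighbors, $\mathrm{cl}(i)=\{i\}\cup \mathrm{ne}(i)$, and $i\not\sim_{\mathcal{G}} j$ means that $i$ and $j$ are not adjacent in $\mathcal{G}$. Separation is defined as follows: for three nonempty subsets $A,B,C\subseteq V$, $C$ separates $A$ from $B$ if every path from a vertex $a\in A$ to a vertex $b\in B$ contains some vertex in $C$. Properties of a ternary relation $\cdot\perp\cdot\mid\cdot$ on $\mathcal{P}(V)$, each required for all (potentially infinite) sets $X,Y,Z,W\in\mathcal{P}(V)$, where $(Y,W)$ denotes $Y\cup W$: - (P1* ) Symmetry: $X \perp Y \mid Z$ implies $Y\perp X\mid Z$. - (P2* ) Decomposition: $X\perp (Y,W)\mid Z$ implies $X\perp Y\mid Z$ and $X\perp W\mid Z$. - (P3* ) Weak union: $X\perp (Y,W)\mid Z$ implies $X\perp Y\mid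 (Z,W)$. - (P4* ) Contraction: $X\perp Y\mid (Z,W)$ and $X\perp W\mid Z$ imply $X\perp (Y,W)\mid Z$. - (P5* ) General intersection: for any partition $X=\bigcup_k X_k$ into finite subsets of $V$, if $X_k\perp Y\mid Z\cup\left(\bigcup_{j\ne k}X_j\right)$ for all $k$, then $X\perp Y\mid Z$. Set-Markov properties of $(V,\perp)$ with respect to $\mathcal{G}$: - (P* ) for each pair of vertices $\{i,j\}\subseteq V$, $i\not\sim_{\mathcal{G}} j$ implies $\{i\}\perp\{j\}\mid V\setminus\{i,j\}$. - (L* ) for each vertex $i$, $\{i\}\perp V\setminus\mathrm{cl}(i)\mid \mathrm{ne}(i)$. - (G* ) for each triple $(A,B,S)$ of disjoint subsets of $V$ with $S$ separating $A$ from $B$, $A\perp B\mid S$.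
   Formalization: Separation, and hence (G* ), is extended by the same formula to empty A, B, S; with nonempty sets only, (G* ) ⇒ (L* ) fails, e.g. for V={1,2}, no edges and the empty relation. *)

theory Defs
  imports Main "HOL-Library.Disjoint_Sets"
begin

(* Edges are two-element sets of vertices, so loops and multiple edges are excluded.
   The vertex set may be infinite. *)
definition undirected_graph :: "'a set \<Rightarrow> 'a set set \<Rightarrow> bool" where
  "undirected_graph V E \<longleftrightarrow> (\<forall>e\<in>E. e \<subseteq> V \<and> card e = 2)"

definition adjacent :: "'a set set \<Rightarrow> 'a \<Rightarrow> 'a \<Rightarrow> bool" where
  "adjacent E i j \<longleftrightarrow> {i, j} \<in> E"

definition ne :: "'a set set \<Rightarrow> 'a \<Rightarrow> 'a set" where
  "ne E i = {j. adjacent E i j}"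

definition cl :: "'a set set \<Rightarrow> 'a \<Rightarrow> 'a set" where
  "cl E i = {i} \<union> ne E i"

definition is_path :: "'a set \<Rightarrow> 'a set set \<Rightarrow> 'a list \<Rightarrow> bool" where
  "is_path V E p \<longleftrightarrow>
     p \<noteq> [] \<and> set p \<subseteq> V \<and> distinct p \<and> successively (adjacent E) p"

(* Empty sets are admitted: the local Markov property at i is the instance ({i}, V - cl i, ne i)
   of the global one, and both V - cl i and ne i may be empty. *)
definition separates :: "'a set \<Rightarrow> 'a set set \<Rightarrow> 'a set \<Rightarrow> 'a set \<Rightarrow> 'a set \<Rightarrow> bool" where
  "separates V E C A B \<longleftrightarrow>
     (\<forall>p. is_path V E p \<and> hd p \<in> A \<and> last p \<in> B \<longrightarrow> set p \<inter> C \<noteq> {})"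

(* Ternary relations on Pow V: ind X Y Z stands for "X is independent of Y given Z";
   its values on sets that are not contained in V are never used. *)
type_synonym 'a ternary = "'a set \<Rightarrow> 'a set \<Rightarrow> 'a set \<Rightarrow> bool"

definition symmetry :: "'a set \<Rightarrow> 'a ternary \<Rightarrow> bool" where
  "symmetry V ind \<longleftrightarrow>
     (\<forall>X\<subseteq>V. \<forall>Y\<subseteq>V. \<forall>Z\<subseteq>V. ind X Y Z \<longrightarrow> ind Y X Z)"

definition decomposition :: "'a set \<Rightarrow> 'a ternary \<Rightarrow> bool" where
  "decomposition V ind \<longleftrightarrow>
     (\<forall>X\<subseteq>V. \<forall>Y\<subseteq>V. \<forall>Z\<subseteq>V. \<forall>W\<subseteq>V.
        ind X (Y \<union> W) Z \<longrightarrow> ind X Y Z \<and> ind X W Z)"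

definition weak_union :: "'a set \<Rightarrow> 'a ternary \<Rightarrow> bool" where
  "weak_union V ind \<longleftrightarrow>
     (\<forall>X\<subseteq>V. \<forall>Y\<subseteq>V. \<forall>Z\<subseteq>V. \<forall>W\<subseteq>V.
        ind X (Y \<union> W) Z \<longrightarrow> ind X Y (Z \<union> W))"

definition contraction :: "'a set \<Rightarrow> 'a ternary \<Rightarrow> bool" where
  "contraction V ind \<longleftrightarrow>
     (\<forall>X\<subseteq>V. \<forall>Y\<subseteq>V. \<forall>Z\<subseteq>V. \<forall>W\<subseteq>V.
        ind X Y (Z \<union> W) \<and> ind X W Z \<longrightarrow> ind X (Y \<union> W) Z)"

(* The partition P of X may have infinitely many blocks, each of them finite.
   For X = {} the only partition is the empty one, which gives ind {} Y Z. *)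
definition general_intersection :: "'a set \<Rightarrow> 'a ternary \<Rightarrow> bool" where
  "general_intersection V ind \<longleftrightarrow>
     (\<forall>X\<subseteq>V. \<forall>Y\<subseteq>V. \<forall>Z\<subseteq>V. \<forall>P.
        partition_on X P \<and> (\<forall>K\<in>P. finite K) \<and>
        (\<forall>K\<in>P. ind K Y (Z \<union> \<Union>(P - {K}))) \<longrightarrow> ind X Y Z)"

definition pairwise_set_Markov :: "'a set \<Rightarrow> 'a set set \<Rightarrow> 'a ternary \<Rightarrow> bool" where
  "pairwise_set_Markov V E ind \<longleftrightarrow>
     (\<forall>i\<in>V. \<forall>j\<in>V. i \<noteq> j \<and> \<not> adjacent E i j \<longrightarrow> ind {i} {j} (V - {i, j}))"

definition local_set_Markov :: "'a set \<Rightarrow> 'a set set \<Rightarrow> 'a ternary \<Rightarrow> bool" where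
  "local_set_Markov V E ind \<longleftrightarrow> (\<forall>i\<in>V. ind {i} (V - cl E i) (ne E i))"

definition global_set_Markov :: "'a set \<Rightarrow> 'a set set \<Rightarrow> 'a ternary \<Rightarrow> bool" where
  "global_set_Markov V E ind \<longleftrightarrow>
     (\<forall>A\<subseteq>V. \<forall>B\<subseteq>V. \<forall>S\<subseteq>V.
        A \<inter> B = {} \<and> A \<inter> S = {} \<and> B \<inter> S = {} \<and> separates V E S A B \<longrightarrow> ind A B S)"

end

theory Submission
  imports Defs
begin

text \<open>For the implication from pairwise to global, enlarge \<open>A\<close> to the set \<open>A'\<close> of all
  vertices reachable from \<open>A\<close> outside \<open>S\<close>, and \<open>B\<close> to \<open>B' = V - S - A'\<close>. No edge joins \<open>A'\<close>
  to \<open>B'\<close>, so the pairwise property holds between all their points; two applications of general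
  intersection to partitions into singletons, first of \<open>B'\<close> and then of \<open>A'\<close>, give
  \<open>A' \<bottom> B' | S\<close>, and decomposition restricts this to \<open>A\<close> and \<open>B\<close>.\<close>

lemma adjacent_sym: "adjacent E i j \<longleftrightarrow> adjacent E j i"
  unfolding adjacent_def by (subst insert_commute) (rule refl)

lemma undirected_graph_adjacentD:
  assumes "undirected_graph V E" and "adjacent E i j"
  shows "i \<in> V" and "j \<in> V" and "i \<noteq> j"
proof -
  have "{i, j} \<subseteq> V" "card {i, j} = 2"
    using assms unfolding undirected_graph_def adjacent_def by blast+
  then show "i \<in> V" "j \<in> V" "i \<noteq> j"
    by (auto simp: card_insert_if)
qed

lemma ne_subset: "undirected_graph V E \<Longrightarrow> ne E i \<subseteq> V"
  unfolding ne_def using undirected_graph_adjacentD(2) by fast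

lemma not_in_ne: "undirected_graph V E \<Longrightarrow> i \<notin> ne E i"
  unfolding ne_def using undirected_graph_adjacentD(3) by fast

text \<open>Since \<open>i\<close> lies in \<open>cl E i\<close>, a path from \<open>i\<close> to a
  vertex outside \<open>cl E i\<close> has a second vertex, and that vertex is a neighbor of
  \<open>i\<close>.\<close>

lemma ne_separates: "separates V E (ne E i) {i} (V - cl E i)"
  unfolding separates_def
proof (intro allI impI)
  fix p
  assume p: "is_path V E p \<and> hd p \<in> {i} \<and> last p \<in> V - cl E i"
  then obtain xs where xs: "p = i # xs"
    by (cases p) (auto simp: is_path_def)
  with p obtain y ys where "xs = y # ys"
    by (cases xs) (auto simp: cl_def)
  with p xs show "set p \<inter> ne E i \<noteq> {}"
    by (auto simp: is_path_def ne_def)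
qed

lemma global_imp_local:
  assumes G: "undirected_graph V E" and "global_set_Markov V E ind"
  shows "local_set_Markov V E ind"
  unfolding local_set_Markov_def
proof
  fix i assume "i \<in> V"
  then show "ind {i} (V - cl E i) (ne E i)"
    using assms(2)[unfolded global_set_Markov_def, rule_format, of "{i}" "V - cl E i" "ne E i"]
      ne_subset[OF G] not_in_ne[OF G] ne_separates[of V E i]
    by (auto simp: cl_def)
qed

text \<open>Weak union moves all non-neighbors of \<open>i\<close> other than \<open>j\<close> into
  the conditioning set, which then consists of everything but \<open>i\<close> and
  \<open>j\<close>.\<close>

lemma local_imp_pairwise:
  assumes G: "undirected_graph V E" and "weak_union V ind" and "local_set_Markov V E ind"
  shows "pairwise_set_Markov V E ind"
  unfolding pairwise_set_Markov_def
proof (intro ballI impI)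
  fix i j
  assume i: "i \<in> V" and j: "j \<in> V" and nadj: "i \<noteq> j \<and> \<not> adjacent E i j"
  let ?W = "V - cl E i - {j}"
  have "V - cl E i = {j} \<union> ?W"
    using j nadj by (auto simp: cl_def ne_def)
  then have "ind {i} ({j} \<union> ?W) (ne E i)"
    using assms(3) i by (simp add: local_set_Markov_def)
  then have "ind {i} {j} (ne E i \<union> ?W)"
    using assms(2)[unfolded weak_union_def, rule_format, of "{i}" "{j}" "ne E i" ?W]
      i j ne_subset[OF G] by auto
  moreover have "ne E i \<union> ?W = V - {i, j}"
    using nadj ne_subset[OF G, of i] not_in_ne[OF G, of i]
    by (auto simp: cl_def ne_def[of E i])
  ultimately show "ind {i} {j} (V - {i, j})" by simp
qed

text \<open>The form in which general intersection is applied: singleton blocks are finite whatever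
  the size of \<open>X\<close>.\<close>

lemma general_intersection_singletons:
  assumes "general_intersection V ind"
    and "X \<subseteq> V" "Y \<subseteq> V" "Z \<subseteq> V"
    and ind: "\<And>x. x \<in> X \<Longrightarrow> ind {x} Y (Z \<union> (X - {x}))"
  shows "ind X Y Z"
proof -
  let ?P = "(\<lambda>x. {x}) ` X"
  have "partition_on X ?P"
    by (auto simp: partition_on_def disjoint_def)
  moreover have "\<Union>(?P - {{x}}) = X - {x}" for x
    by auto
  then have "\<forall>K\<in>?P. ind K Y (Z \<union> \<Union>(?P - {K}))"
    using ind by simp
  moreover have "\<forall>K\<in>?P. finite K" by simp
  ultimately show ?thesis
    using assms(1)[unfolded general_intersection_def, rule_format, of X Y Z ?P] assms(2-4)
    by blast
qed

text \<open>This is the union of those connected components of the subgraph induced on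
  \<open>V - S\<close> that meet \<open>A\<close>. Describing it by endpoints of paths lets the
  definition of separation apply directly.\<close>

definition reach_avoiding :: "'a set \<Rightarrow> 'a set set \<Rightarrow> 'a set \<Rightarrow> 'a set \<Rightarrow> 'a set" where
  "reach_avoiding V E S A = {last p |p. is_path V E p \<and> hd p \<in> A \<and> set p \<inter> S = {}}"

lemma reach_avoiding_subset: "reach_avoiding V E S A \<subseteq> V - S"
proof
  fix v assume "v \<in> reach_avoiding V E S A"
  then obtain p where p: "is_path V E p" "set p \<inter> S = {}" "v = last p"
    by (auto simp: reach_avoiding_def)
  then have "v \<in> set p" by (simp add: is_path_def)
  moreover have "set p \<subseteq> V" using p by (simp add: is_path_def)
  ultimately show "v \<in> V - S" using p(2) by blast
qed

lemma subset_reach_avoiding: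
  assumes "A \<subseteq> V" "A \<inter> S = {}"
  shows "A \<subseteq> reach_avoiding V E S A"
proof
  fix a assume "a \<in> A"
  with assms have "is_path V E [a] \<and> hd [a] \<in> A \<and> set [a] \<inter> S = {}"
    by (auto simp: is_path_def)
  moreover have "a = last [a]" by simp
  ultimately show "a \<in> reach_avoiding V E S A"
    unfolding reach_avoiding_def by blast
qed

lemma separates_reach_avoiding:
  "separates V E S A B \<Longrightarrow> reach_avoiding V E S A \<inter> B = {}"
  unfolding separates_def reach_avoiding_def by blast

lemma reach_avoiding_adjacent:
  assumes a: "a \<in> reach_avoiding V E S A" and adj: "adjacent E a b" and b: "b \<in> V - S"
  shows "b \<in> reach_avoiding V E S A"
proof -
  obtain p where p: "is_path V E p" "hd p \<in> A" "set p \<inter> S = {}" "a = last p"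
    using a by (auto simp: reach_avoiding_def)
  have "\<exists>q. is_path V E q \<and> hd q \<in> A \<and> set q \<inter> S = {} \<and> last q = b"
  proof (cases "b \<in> set p")
    \<comment> \<open>Appending \<open>b\<close> would repeat a vertex, so the path is cut off at an
      occurrence of \<open>b\<close> instead.\<close>
    case True
    then obtain xs ys where "p = (xs @ [b]) @ ys"
      by (auto simp: in_set_conv_decomp)
    with p have "is_path V E (xs @ [b]) \<and> hd (xs @ [b]) \<in> A \<and> set (xs @ [b]) \<inter> S = {}"
      by (auto simp: is_path_def successively_append_iff hd_append split: if_splits)
    then show ?thesis by (intro exI[of _ "xs @ [b]"]) simp
  next
    case False
    with p adj b have "is_path V E (p @ [b])"
      by (auto simp: is_path_def successively_append_iff)
    moreover have "hd (p @ [b]) \<in> A"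
      using p by (simp add: is_path_def)
    moreover have "set (p @ [b]) \<inter> S = {}"
      using p b by auto
    ultimately show ?thesis by (intro exI[of _ "p @ [b]"]) simp
  qed
  then show ?thesis unfolding reach_avoiding_def by blast
qed

text \<open>General intersection splits only the left argument, so symmetry exchanges the two sides
  between its two uses.\<close>

lemma pairwise_imp_ind_of_no_edge:
  assumes sym: "symmetry V ind" and gi: "general_intersection V ind"
    and pw: "pairwise_set_Markov V E ind"
    and V: "V = A \<union> B \<union> S" and disj: "A \<inter> B = {}" "A \<inter> S = {}" "B \<inter> S = {}"
    and nadj: "\<And>a b. a \<in> A \<Longrightarrow> b \<in> B \<Longrightarrow> \<not> adjacent E a b"
  shows "ind A B S"
proof (rule general_intersection_singletons[OF gi])
  fix a assume a: "a \<in> A"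
  have "ind B {a} (S \<union> (A - {a}))"
  proof (rule general_intersection_singletons[OF gi])
    fix b assume b: "b \<in> B"
    \<comment> \<open>The remainders contributed by the two intersections, together with
      \<open>S\<close>, fill up exactly the conditioning set of the pairwise property.\<close>
    have "S \<union> (A - {a}) \<union> (B - {b}) = V - {b, a}"
      using V disj a b by auto
    moreover have "b \<in> V" "a \<in> V" "b \<noteq> a" "\<not> adjacent E b a"
      using a b V disj nadj[OF a b] adjacent_sym[of E a b] by auto
    then have "ind {b} {a} (V - {b, a})"
      using pw by (simp add: pairwise_set_Markov_def)
    ultimately show "ind {b} {a} (S \<union> (A - {a}) \<union> (B - {b}))" by simp
  qed (use V a in auto)
  moreover have "B \<subseteq> V" "{a} \<subseteq> V" "S \<union> (A - {a}) \<subseteq> V" using V a by auto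
  ultimately show "ind {a} B (S \<union> (A - {a}))"
    using sym unfolding symmetry_def by blast
qed (use V in auto)

text \<open>Decomposition shrinks the right argument; conjugating it with symmetry shrinks the left
  one.\<close>

lemma ind_mono:
  assumes sym: "symmetry V ind" and dec: "decomposition V ind"
    and ind: "ind X Y Z" and sub: "X \<subseteq> V" "Y \<subseteq> V" "Z \<subseteq> V" "A \<subseteq> X" "B \<subseteq> Y"
  shows "ind A B Z"
proof -
  have right: "ind U B' Z" if "ind U Y' Z" "B' \<subseteq> Y'" "U \<subseteq> V" "Y' \<subseteq> V" for U B' Y'
  proof -
    have "B' \<union> Y' = Y'" using that by blast
    with that have "ind U (B' \<union> Y') Z" by simp
    moreover have "B' \<subseteq> V" using that by blast
    ultimately show ?thesis
      using dec that sub(3) unfolding decomposition_def by blast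
  qed
  have "B \<subseteq> V" using sub by blast
  have "ind X B Z" using right ind sub by blast
  then have "ind B X Z" using sym sub \<open>B \<subseteq> V\<close> unfolding symmetry_def by blast
  then have "ind B A Z" using right sub \<open>B \<subseteq> V\<close> by blast
  moreover have "A \<subseteq> V" using sub by blast
  ultimately show ?thesis using sym sub \<open>B \<subseteq> V\<close> unfolding symmetry_def by blast
qed

lemma pairwise_imp_global:
  assumes sym: "symmetry V ind" and dec: "decomposition V ind"
    and gi: "general_intersection V ind" and pw: "pairwise_set_Markov V E ind"
  shows "global_set_Markov V E ind"
  unfolding global_set_Markov_def
proof (intro allI impI)
  fix A B S
  assume sub: "A \<subseteq> V" "B \<subseteq> V" "S \<subseteq> V"
    and H: "A \<inter> B = {} \<and> A \<inter> S = {} \<and> B \<inter> S = {} \<and> separates V E S A B"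
  define A' where "A' = reach_avoiding V E S A"
  define B' where "B' = V - S - A'"
  have A': "A' \<subseteq> V - S"
    unfolding A'_def by (rule reach_avoiding_subset)
  have "ind A' B' S"
  proof (rule pairwise_imp_ind_of_no_edge[OF sym gi pw])
    show "\<not> adjacent E a b" if "a \<in> A'" "b \<in> B'" for a b
      using that reach_avoiding_adjacent[of a V E S A b] by (auto simp: A'_def B'_def)
  qed (use A' sub in \<open>auto simp: B'_def\<close>)
  moreover have "A \<subseteq> A'"
    unfolding A'_def using H sub by (intro subset_reach_avoiding) auto
  \<comment> \<open>Separation enters here: a path from \<open>A\<close> that avoids
    \<open>S\<close> cannot end in \<open>B\<close>, so \<open>B\<close> misses
    \<open>A'\<close>.\<close>
  moreover have "B \<subseteq> B'"
    using H sub separates_reach_avoiding[of V E S A B] by (auto simp: A'_def B'_def)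
  moreover have "A' \<subseteq> V" "B' \<subseteq> V"
    using A' by (auto simp: B'_def)
  ultimately show "ind A B S"
    using ind_mono[OF sym dec] sub by blast
qed

theorem theorem2p3:
  fixes V :: "'a set" and E :: "'a set set" and ind :: "'a set \<Rightarrow> 'a set \<Rightarrow> 'a set \<Rightarrow> bool"
  assumes "undirected_graph V E"
    and "symmetry V ind"
    and "decomposition V ind"
    and "weak_union V ind"
    and "contraction V ind"
  shows "(global_set_Markov V E ind \<longrightarrow> local_set_Markov V E ind) \<and>
         (local_set_Markov V E ind \<longrightarrow> pairwise_set_Markov V E ind) \<and>
         (general_intersection V ind \<longrightarrow>
            (pairwise_set_Markov V E ind \<longrightarrow> global_set_Markov V E ind))"
  using global_imp_local[OF assms(1)] local_imp_pairwise[OF assms(1,4)]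
    pairwise_imp_global[OF assms(2,3)] by blast

end
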